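(* Let $E:[0,\overline x^{br}]\to\mathbb R^b$ be the restricted-transmission-expansion map $\hat x^{br}\mapsto\tilde x^{br}=E(\hat x^{br})$ defined by the procedure in the context (for fixed nodal net injections $\{p^{ni*}_\omega\}_\omega$ and a fixed vector $x^{br*}\in[0,\overline x^{br}]$). Then a fixed point exists: there is $\hat x^{br}\in[0,\overline x^{br}]$ with $\hat x^{br}=E(\hat x^{br})$.
   Context: A connected network has $N$ nodes and $b$ AC branches, with incidence matrix $A^{br}\in\{-1,0,1\}^{N\times b}$ (each branch has a "from" bus with entry $+1$ and a "to" bus with entry $-1$); $A\in\mathbb R^{b\times(N-1)}$ is $(A^{br})^\top$ with the column of the slack bus (bus 1) removed. $\mathcal B\subseteq[b]$ is the set of non-bridge branches (branches whose removal does not disconnect the network). $\overline w^{br}\in\mathbb R^b_{\ge 0}$ are existing branch capacities, $\overline x^{br}\in\mathbb R^b_{\ge0}$ are upper bounds on capacity upgrades, and $[0,\overline x^{br}]=\prod_i[0,\overline x^{br}_i]$. The impedance of branch $j$ is a continuous positive function $\chi_j(x^{br}_j)$ of its upgrade on $[0,\overline x^{br}_j]$ (e.g. $\chi_j(x_j^{br})=\chi_j^0\overline w_j^{br}/(\overline w_j^{br}+x_j^{br})$ with $\chi^0_j,\overline w^{br}_j>0$). Set $$B(x^{br})=\mathrm{diag}(\chi(x^{br}))^{-1},\quad \Phi(x^{br})=B(x^{br})A[A^\top B(x^{br})A]^{-1},\quad \Lambda(x^{br})=\Phi(x^{br})A^\top[I-\mathrm{diag}(\Phi(x^{br})A^\top)]^{-1},$$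 where $\mathrm{diag}$ of a matrix keeps the diagonal part, and only the columns of $\Lambda$ indexed by $j\in\mathcal B$ are used, i.e. $\Lambda_{ij}=(\Phi A^\top)_{ij}/(1-(\Phi A^\top)_{jj})$ for $j\in\mathcal B$. $\Phi_i$ is the $i$-th row of $\Phi$. Further fixed data: a finite set $\Omega$ of scenarios, $T$ hours, vectors $p^{ni*}_{\omega t}\in\mathbb R^N$ for $\omega\in\Omega,t\in[T]$ ($p^{ni*}_{\omega t,[2:N]}$ omits the slack bus entry), branch unit costs $c^{br}_i>0$, violation penalty $c^{vio}>0$, post-contingency rating multiple $\eta^c\ge1$, a vector $x^{br*}\in[0,\overline x^{br}]$. $[\cdot]^+=\max\{\cdot,0\}$. Definition of $\tilde x^{br}=E(\hat x^{br})$: for each branch $i\in[b]$, 1. for all $\omega\in\Omega,t\in[T]$: $\hat p^{br}_{\omega ti}=\Phi_i(\hat x^{br})\,p^{ni*}_{\omega t,[2:N]}$; for $j\in\mathcal B\setminus\{i\}$: $\hat p^{brc}_{\omega tij}=\hat p^{br}_{\omega ti}+\Lambda_{ij}(\hat x^{br})\hat p^{br}_{\omega tj}$; $\hat\delta^{base}_{\omega ti}=[\,|\hat p^{br}_{\omega ti}|-\overline w^{br}_i]^+$; $\hat\delta^c_{\omega tij}=[\,|\hat p^{brc}_{\omega tij}|-\eta^c\overline w^{br}_i]^+$; 2. $x^{br\text{-}lb}_i=\max_{\omega,t}\hat\delta^{base}_{\omega ti}$; 3. $r_i=\lceil c^{br}_i/(\eta^cc^{vio})\rceil$, $v_i$ is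 the array (with multiplicity) $\{\hat\delta^c_{\omega tij}/\eta^c\}_{\omega\in\Omega,t\in[T],j\in\mathcal B\setminus\{i\}}$, and $x^{opt}_i$ is the $r_i$-th largest value in $v_i$ (it is assumed that $r_i$ does not exceed the length of $v_i$); 4. $\tilde x^{br}_i=\min\{\max\{x^{br*}_i,x^{br\text{-}lb}_i,x^{opt}_i\},\overline x^{br}_i\}$. *)

theory Defs
  imports
    "HOL-Analysis.Analysis"
    "HOL-Library.Multiset"
    "Graph_Theory.Digraph_Component"
begin

text \<open>
  The network is a directed multigraph \<open>G\<close> whose bus set is the whole of \<open>'n option\<close> and whose
  branch set is the whole of \<open>'b\<close>; \<open>tail G j\<close> is the "from" bus and \<open>head G j\<close> the "to" bus of
  branch \<open>j\<close>. The slack bus is \<open>None\<close>, so the remaining \<open>N - 1\<close> buses are the \<open>Some k\<close> and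
  dropping the slack entry of a vector over the buses gives a vector indexed by \<open>'n\<close>.
\<close>

definition network :: "('n::finite option, 'b::finite) pre_digraph \<Rightarrow> bool" where
  "network G \<longleftrightarrow>
     loopfree_digraph G \<and> verts G = UNIV \<and> arcs G = UNIV \<and> Digraph_Component.connected G"

definition non_bridges :: "('n::finite option, 'b::finite) pre_digraph \<Rightarrow> 'b set" where
  "non_bridges G = {j. Digraph_Component.connected (pre_digraph.del_arc G j)}"

definition incidence :: "('n::finite option, 'b::finite) pre_digraph \<Rightarrow> real^'b^('n option)" where
  "incidence G = (\<chi> v j. if v = tail G j then 1 else if v = head G j then -1 else 0)"

definition drop_slack :: "'a^('n::finite option) \<Rightarrow> 'a^'n" where
  "drop_slack p = (\<chi> k. p $ Some k)"

definition reduced_incidence :: "('n::finite option, 'b::finite) pre_digraph \<Rightarrow> real^'n^'b" where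
  "reduced_incidence G = (\<chi> j. drop_slack (transpose (incidence G) $ j))"

definition diag_of :: "real^'b \<Rightarrow> real^'b^'b" where
  "diag_of v = (\<chi> i j. if i = j then v $ i else 0)"

text \<open>Throughout, \<open>z j s\<close> is the impedance of branch \<open>j\<close> when its upgrade is \<open>s\<close>.\<close>

definition susceptance :: "('b::finite \<Rightarrow> real \<Rightarrow> real) \<Rightarrow> real^'b \<Rightarrow> real^'b^'b" where
  "susceptance z x = matrix_inv (diag_of (\<chi> j. z j (x $ j)))"

definition ptdf ::
  "('n::finite option, 'b::finite) pre_digraph \<Rightarrow> ('b \<Rightarrow> real \<Rightarrow> real) \<Rightarrow> real^'b \<Rightarrow> real^'n^'b" where
  "ptdf G z x =
     (let A = reduced_incidence G; B = susceptance z x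
      in B ** A ** matrix_inv (transpose A ** B ** A))"

text \<open>
  The matrix \<open>\<Phi> A\<^sup>T [I - diag (\<Phi> A\<^sup>T)]\<^sup>-\<^sup>1\<close> is given entrywise, because its second factor
  is singular as soon as the network has a bridge. Only the columns \<open>j \<in> non_bridges G\<close> are
  meaningful, and only these are used below.
\<close>

definition lodf ::
  "('n::finite option, 'b::finite) pre_digraph \<Rightarrow> ('b \<Rightarrow> real \<Rightarrow> real) \<Rightarrow> real^'b \<Rightarrow> real^'b^'b" where
  "lodf G z x =
     (let M = ptdf G z x ** transpose (reduced_incidence G)
      in \<chi> i j. M $ i $ j / (1 - M $ j $ j))"

definition base_flow ::
  "('n::finite option, 'b::finite) pre_digraph \<Rightarrow> ('b \<Rightarrow> real \<Rightarrow> real) \<Rightarrow>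
   ('w \<Rightarrow> nat \<Rightarrow> real^('n option)) \<Rightarrow> real^'b \<Rightarrow> 'w \<Rightarrow> nat \<Rightarrow> 'b \<Rightarrow> real" where
  "base_flow G z p x \<omega> t i = ptdf G z x $ i \<bullet> drop_slack (p \<omega> t)"

definition contingency_flow ::
  "('n::finite option, 'b::finite) pre_digraph \<Rightarrow> ('b \<Rightarrow> real \<Rightarrow> real) \<Rightarrow>
   ('w \<Rightarrow> nat \<Rightarrow> real^('n option)) \<Rightarrow> real^'b \<Rightarrow> 'w \<Rightarrow> nat \<Rightarrow> 'b \<Rightarrow> 'b \<Rightarrow> real" where
  "contingency_flow G z p x \<omega> t i j =
     base_flow G z p x \<omega> t i + lodf G z x $ i $ j * base_flow G z p x \<omega> t j"

definition base_violation ::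
  "('n::finite option, 'b::finite) pre_digraph \<Rightarrow> ('b \<Rightarrow> real \<Rightarrow> real) \<Rightarrow> real^'b \<Rightarrow>
   ('w \<Rightarrow> nat \<Rightarrow> real^('n option)) \<Rightarrow> real^'b \<Rightarrow> 'w \<Rightarrow> nat \<Rightarrow> 'b \<Rightarrow> real" where
  "base_violation G z w p x \<omega> t i = max (\<bar>base_flow G z p x \<omega> t i\<bar> - w $ i) 0"

definition contingency_violation ::
  "('n::finite option, 'b::finite) pre_digraph \<Rightarrow> ('b \<Rightarrow> real \<Rightarrow> real) \<Rightarrow> real^'b \<Rightarrow> real \<Rightarrow>
   ('w \<Rightarrow> nat \<Rightarrow> real^('n option)) \<Rightarrow> real^'b \<Rightarrow> 'w \<Rightarrow> nat \<Rightarrow> 'b \<Rightarrow> 'b \<Rightarrow> real" where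
  "contingency_violation G z w \<eta> p x \<omega> t i j =
     max (\<bar>contingency_flow G z p x \<omega> t i j\<bar> - \<eta> * w $ i) 0"

definition capacity_lb ::
  "('n::finite option, 'b::finite) pre_digraph \<Rightarrow> ('b \<Rightarrow> real \<Rightarrow> real) \<Rightarrow> real^'b \<Rightarrow>
   'w set \<Rightarrow> nat \<Rightarrow> ('w \<Rightarrow> nat \<Rightarrow> real^('n option)) \<Rightarrow> real^'b \<Rightarrow> 'b \<Rightarrow> real" where
  "capacity_lb G z w \<Omega> T p x i = Max {base_violation G z w p x \<omega> t i | \<omega> t. \<omega> \<in> \<Omega> \<and> t \<in> {1..T}}"

text \<open>Counted with multiplicity; intended for \<open>1 \<le> r \<le> size M\<close>.\<close>

definition nth_largest :: "nat \<Rightarrow> real multiset \<Rightarrow> real" where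
  "nth_largest r M = rev (sorted_list_of_multiset M) ! (r - 1)"

definition upgrade_rank :: "real \<Rightarrow> real^'b \<Rightarrow> real \<Rightarrow> 'b \<Rightarrow> nat" where
  "upgrade_rank \<eta> c cvio i = nat \<lceil>c $ i / (\<eta> * cvio)\<rceil>"

definition violation_array ::
  "('n::finite option, 'b::finite) pre_digraph \<Rightarrow> ('b \<Rightarrow> real \<Rightarrow> real) \<Rightarrow> real^'b \<Rightarrow> real \<Rightarrow>
   'w set \<Rightarrow> nat \<Rightarrow> ('w \<Rightarrow> nat \<Rightarrow> real^('n option)) \<Rightarrow> real^'b \<Rightarrow> 'b \<Rightarrow> real multiset" where
  "violation_array G z w \<eta> \<Omega> T p x i =
     {# contingency_violation G z w \<eta> p x \<omega> t i j / \<eta>.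
        (\<omega>, t, j) \<in># mset_set (\<Omega> \<times> {1..T} \<times> (non_bridges G - {i})) #}"

definition optimal_upgrade ::
  "('n::finite option, 'b::finite) pre_digraph \<Rightarrow> ('b \<Rightarrow> real \<Rightarrow> real) \<Rightarrow> real^'b \<Rightarrow> real \<Rightarrow>
   real^'b \<Rightarrow> real \<Rightarrow> 'w set \<Rightarrow> nat \<Rightarrow> ('w \<Rightarrow> nat \<Rightarrow> real^('n option)) \<Rightarrow> real^'b \<Rightarrow> 'b \<Rightarrow> real" where
  "optimal_upgrade G z w \<eta> c cvio \<Omega> T p x i =
     nth_largest (upgrade_rank \<eta> c cvio i) (violation_array G z w \<eta> \<Omega> T p x i)"

definition expansion_map ::
  "('n::finite option, 'b::finite) pre_digraph \<Rightarrow> ('b \<Rightarrow> real \<Rightarrow> real) \<Rightarrow> real^'b \<Rightarrow> real^'b \<Rightarrow>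
   real \<Rightarrow> real^'b \<Rightarrow> real \<Rightarrow> 'w set \<Rightarrow> nat \<Rightarrow> ('w \<Rightarrow> nat \<Rightarrow> real^('n option)) \<Rightarrow> real^'b \<Rightarrow>
   real^'b \<Rightarrow> real^'b" where
  "expansion_map G z w xbar \<eta> c cvio \<Omega> T p xstar x =
     (\<chi> i. min (Max {xstar $ i, capacity_lb G z w \<Omega> T p x i,
                     optimal_upgrade G z w \<eta> c cvio \<Omega> T p x i})
               (xbar $ i))"

end

theory Submission
  imports Defs
begin

text \<open>
  The expansion map sends the box \<open>{0..xbar}\<close> into itself, because its last step clamps the
  upgrade of every branch to at most \<open>xbar\<close> and the upgrade is at least \<open>xstar\<close>, hence
  nonnegative. So Brouwer's theorem gives the fixed point once the map is known to be continuous on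
  the box. It is composed of absolute values, maxima, minima, an order statistic and the
  sensitivity matrices \<open>ptdf\<close> and \<open>lodf\<close>, and only two kinds of ingredient could fail to be
  continuous: the matrices, which involve an inverse and a quotient, and the order statistic.

  Write \<open>A\<close> for the reduced incidence matrix, \<open>D\<close> for the diagonal matrix of susceptances, which
  are positive on the box, and \<open>K = A\<^sup>T D A\<close>. A vector \<open>u\<close> assigns a potential to every bus, with
  potential \<open>0\<close> at the slack bus; \<open>A u\<close> lists the potential differences along the branches, and
  \<open>u\<^sup>T K u\<close> is the energy \<open>\<Sum>\<^sub>k d\<^sub>k (A u)\<^sub>k\<^sup>2\<close>. If the energy vanishes, then connectivity makes the
  potential constant, so it is \<open>0\<close>. Thus \<open>K\<close> is invertible
  (\<open>weighted_gram_invertible\<close>), and \<open>K\<^sup>-\<^sup>1\<close> is continuous by Cramer's rule.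

  The denominators of \<open>lodf\<close> are \<open>1 - d\<^sub>j y\<^sub>j\<close>, where \<open>y = A u\<close> and \<open>u = K\<^sup>-\<^sup>1 a\<^sub>j\<close> is the response
  to one unit of power sent from one end of branch \<open>j\<close> to the other. The total energy of \<open>u\<close> is
  \<open>u\<^sup>T a\<^sub>j = y\<^sub>j\<close>. If \<open>d\<^sub>j y\<^sub>j = 1\<close>, then branch \<open>j\<close> alone carries the energy
  \<open>d\<^sub>j y\<^sub>j\<^sup>2 = y\<^sub>j\<close>, so no other branch sees a potential difference. As the network
  without a non-bridge \<open>j\<close> is still connected, the potential is \<open>0\<close>, contradicting
  \<open>d\<^sub>j y\<^sub>j = 1\<close> (\<open>weighted_gram_projection_diag_neq_1\<close>).

  Finally, the \<open>r\<close>-th largest of finitely many numbers moves by at most \<open>e\<close> when each of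
  them moves by at most \<open>e\<close> (\<open>nth_largest_perturb\<close>), which gives the continuity of the order
  statistic.
\<close>

section \<open>Continuity of matrix-valued maps\<close>

lemma continuous_on_matrix_mult:
  fixes f :: "'a::topological_space \<Rightarrow> real^'m^'n" and g :: "'a \<Rightarrow> real^'k^'m"
  assumes "continuous_on S f" "continuous_on S g"
  shows "continuous_on S (\<lambda>x. f x ** g x)"
  unfolding matrix_matrix_mult_def by (intro continuous_intros assms)

lemma continuous_on_det:
  fixes f :: "'a::topological_space \<Rightarrow> real^'n^'n"
  assumes "continuous_on S f"
  shows "continuous_on S (\<lambda>x. det (f x))"
  unfolding det_def by (intro continuous_intros assms)

lemma matrix_inv_eqI:
  fixes A B :: "real^'n^'n"
  assumes "A ** B = mat 1"
  shows "matrix_inv A = B"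
proof -
  have "A ** matrix_inv A = mat 1 \<and> matrix_inv A ** A = mat 1"
    unfolding matrix_inv_def by (rule someI[of _ B]) (use assms matrix_left_right_inverse in auto)
  then show ?thesis
    by (metis assms matrix_mul_assoc matrix_mul_lid matrix_mul_rid)
qed

lemma matrix_inv_right_inverse:
  fixes A :: "real^'n^'n"
  assumes "invertible A"
  shows "A ** matrix_inv A = mat 1"
  using assms matrix_inv_eqI unfolding invertible_def by metis

text \<open>Cramer's rule writes every entry of the inverse as a quotient of two determinants.\<close>

lemma continuous_on_matrix_inv:
  fixes f :: "'a::topological_space \<Rightarrow> real^'n^'n"
  assumes cont: "continuous_on S f" and inv: "\<And>x. x \<in> S \<Longrightarrow> invertible (f x)"
  shows "continuous_on S (\<lambda>x. matrix_inv (f x))"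
proof -
  define C where "C = (\<lambda>x. \<chi> k l. det (\<chi> i j. if j = k then axis l 1 $ i else f x $ i $ j) / det (f x))"
  have "matrix_inv (f x) = C x" if "x \<in> S" for x
  proof -
    have d: "det (f x) \<noteq> 0"
      using inv[OF that] by (simp add: invertible_det_nz)
    have "f x *v (matrix_inv (f x) *v axis l 1) = axis l 1" for l
      by (simp add: matrix_vector_mul_assoc matrix_inv_right_inverse inv that)
    then have "matrix_inv (f x) *v axis l 1 =
        (\<chi> k. det (\<chi> i j. if j = k then axis l 1 $ i else f x $ i $ j) / det (f x))" for l
      by (simp only: cramer[OF d])
    then show ?thesis
      by (simp add: C_def vec_eq_iff matrix_vector_mul_component inner_axis)
  qed
  moreover have "continuous_on S C"
    unfolding C_def
  proof (intro continuous_intros continuous_on_det cont)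
    show "continuous_on S (\<lambda>x. if j = k then axis l 1 $ i else f x $ i $ j)" for i j k l
      by (cases "j = k") (auto intro!: continuous_intros cont)
    show "\<forall>x\<in>S. det (f x) \<noteq> 0"
      using inv by (simp add: invertible_det_nz)
  qed
  ultimately show ?thesis
    by (simp cong: continuous_on_cong)
qed

section \<open>Weighted Gram matrices\<close>

lemma diag_of_mult_vec: "diag_of d *v y = (\<chi> i. d $ i * y $ i)"
  by (simp add: diag_of_def matrix_vector_mult_def vec_eq_iff if_distrib[of "\<lambda>a. a * _"] cong: if_cong)

lemma weighted_gram_quadratic_form:
  fixes A :: "real^'n^'b"
  shows "u \<bullet> ((transpose A ** diag_of d ** A) *v u) = (\<Sum>k\<in>UNIV. d $ k * ((A *v u) $ k)\<^sup>2)"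
proof -
  have "u \<bullet> ((transpose A ** diag_of d ** A) *v u)
      = (transpose A *v (diag_of d *v (A *v u))) \<bullet> u"
    by (simp add: matrix_vector_mul_assoc matrix_mul_assoc inner_commute)
  also have "\<dots> = (diag_of d *v (A *v u)) \<bullet> (A *v u)"
    by (simp add: dot_lmul_matrix)
  finally show ?thesis
    by (simp add: diag_of_mult_vec inner_vec_def power2_eq_square mult.assoc)
qed

lemma weighted_gram_invertible:
  fixes A :: "real^'n^'b"
  assumes d: "\<And>k. d $ k > 0" and ker: "\<And>u. A *v u = 0 \<Longrightarrow> u = 0"
  shows "invertible (transpose A ** diag_of d ** A)"
proof -
  have "u = 0" if "(transpose A ** diag_of d ** A) *v u = 0" for u
  proof (rule ker)
    have "(\<Sum>k\<in>UNIV. d $ k * ((A *v u) $ k)\<^sup>2) = 0"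
      using weighted_gram_quadratic_form[of u A d] that by simp
    then have "\<forall>k. d $ k * ((A *v u) $ k)\<^sup>2 = 0"
      using d by (simp add: sum_nonneg_eq_0_iff less_imp_le)
    then show "A *v u = 0"
      using d by (simp add: vec_eq_iff less_imp_neq[symmetric])
  qed
  then show ?thesis
    unfolding invertible_left_inverse matrix_left_invertible_ker by blast
qed

text \<open>
  With \<open>K = A\<^sup>T D A\<close>, the matrix \<open>D A K\<^sup>-\<^sup>1 A\<^sup>T\<close> is the transpose of the \<open>D\<close>-orthogonal
  projection onto the range of \<open>A\<close>. A diagonal entry \<open>1\<close> would put the whole energy of
  \<open>u = K\<^sup>-\<^sup>1 a\<^sub>j\<close>, where \<open>a\<^sub>j\<close> is the \<open>j\<close>-th row of \<open>A\<close>, into the \<open>j\<close>-th coordinate of \<open>A u\<close>;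
  the kernel assumption says that no nonzero \<open>u\<close> does this.
\<close>

lemma weighted_gram_projection_diag_neq_1:
  fixes A :: "real^'n^'b"
  assumes d: "\<And>k. d $ k > 0"
    and ker: "\<And>u. (\<And>k. k \<noteq> j \<Longrightarrow> (A *v u) $ k = 0) \<Longrightarrow> u = 0"
  shows "(diag_of d ** A ** matrix_inv (transpose A ** diag_of d ** A) ** transpose A) $ j $ j \<noteq> 1"
proof
  define K where "K = transpose A ** diag_of d ** A"
  define u where "u = matrix_inv K *v (A $ j)"
  define y where "y = A *v u"
  assume one: "(diag_of d ** A ** matrix_inv (transpose A ** diag_of d ** A) ** transpose A) $ j $ j = 1"
  have col: "transpose A *v axis j 1 = A $ j"
    by (simp add: matrix_vector_mul_component vec_eq_iff inner_axis transpose_def)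
  have "(diag_of d ** A ** matrix_inv K ** transpose A) *v axis j 1
      = diag_of d *v (A *v (matrix_inv K *v (transpose A *v axis j 1)))"
    by (simp only: matrix_vector_mul_assoc matrix_mul_assoc)
  also have "\<dots> = diag_of d *v y"
    by (simp only: col u_def y_def)
  finally have "(diag_of d ** A ** matrix_inv K ** transpose A) $ j $ j = d $ j * y $ j"
    by (simp add: diag_of_mult_vec vec_eq_iff matrix_vector_mul_component inner_axis)
  then have dy: "d $ j * y $ j = 1"
    using one by (simp add: K_def)
  have "invertible K"
    unfolding K_def using d ker by (intro weighted_gram_invertible) auto
  then have "K *v u = A $ j"
    by (simp add: u_def matrix_vector_mul_assoc matrix_inv_right_inverse)
  then have "(\<Sum>k\<in>UNIV. d $ k * (y $ k)\<^sup>2) = u \<bullet> A $ j"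
    using weighted_gram_quadratic_form[of u A d] by (simp add: K_def y_def)
  also have "\<dots> = y $ j"
    by (simp add: y_def matrix_vector_mul_component inner_commute)
  also have "\<dots> = d $ j * (y $ j)\<^sup>2"
    using dy by (simp add: power2_eq_square)
  \<comment> \<open>The coordinate \<open>j\<close> accounts for all of the energy, so nothing is left for the others.\<close>
  finally have "(\<Sum>k\<in>UNIV - {j}. d $ k * (y $ k)\<^sup>2) = 0"
    by (simp add: sum.remove[of UNIV j])
  then have "\<forall>k\<in>UNIV - {j}. d $ k * (y $ k)\<^sup>2 = 0"
    using d by (subst (asm) sum_nonneg_eq_0_iff) (auto simp: less_imp_le)
  then have "y $ k = 0" if "k \<noteq> j" for k
    using d[of k] that
    by (metis Diff_iff UNIV_I mult_eq_0_iff order_less_irrefl power_zero_numeral singletonD zero_eq_power2)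
  then have "u = 0"
    unfolding y_def by (rule ker)
  then show False
    using dy by (simp add: y_def)
qed

section \<open>Potentials on connected networks\<close>

lemma connected_imp_constant_potential:
  assumes "Digraph_Component.connected G"
    and eq: "\<And>e. e \<in> arcs G \<Longrightarrow> \<phi> (tail G e) = \<phi> (head G e)"
    and "u \<in> verts G" "v \<in> verts G"
  shows "\<phi> u = \<phi> v"
proof -
  have "u \<rightarrow>\<^sup>*\<^bsub>mk_symmetric G\<^esub> v"
    using assms by (simp add: connected_def strongly_connected_def)
  then show ?thesis
    unfolding reachable_def by (induction rule: rtrancl_on_induct) (use eq in \<open>auto simp: parcs_mk_symmetric\<close>)
qed

text \<open>
  The slack bus is the reference bus, of potential \<open>0\<close>. This extension of \<open>u\<close> to all buses turns
  \<open>reduced_incidence G *v u\<close> into plain potential differences.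
\<close>

definition potential :: "real^'n \<Rightarrow> 'n option \<Rightarrow> real" where
  "potential u v = (case v of None \<Rightarrow> 0 | Some k \<Rightarrow> u $ k)"

text \<open>
  The matrix \<open>incidence\<close> would give a loop the entry \<open>1\<close> rather than \<open>0\<close>, so the formula rests on the
  network being free of loops.
\<close>

lemma reduced_incidence_mult_vec:
  assumes "network G"
  shows "(reduced_incidence G *v u) $ j = potential u (tail G j) - potential u (head G j)"
proof -
  interpret loopfree_digraph G
    using assms by (simp add: network_def)
  have ne: "tail G j \<noteq> head G j"
    using assms no_loops[of j] by (simp add: network_def)
  have sum_if: "(\<Sum>k\<in>UNIV. if Some k = v then u $ k else 0) = potential u v" for v
    by (cases v) (auto simp: potential_def)
  have "(reduced_incidence G *v u) $ j =
      (\<Sum>k\<in>UNIV. (if Some k = tail G j then u $ k else 0) - (if Some k = head G j then u $ k else 0))"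
    unfolding matrix_vector_mult_def
    by (auto simp: reduced_incidence_def drop_slack_def transpose_def incidence_def ne ne[symmetric] intro!: sum.cong)
  then show ?thesis
    by (simp add: sum_subtractf sum_if)
qed

text \<open>
  Used twice: with \<open>H = G\<close> for the invertibility of the Gram matrix, and with \<open>H\<close> equal to \<open>G\<close>
  without a non-bridge for the denominators of the outage factors.
\<close>

lemma connected_subnetwork_potential_eq_0:
  assumes "network G" and H: "Digraph_Component.connected H" "verts H = UNIV"
      "tail H = tail G" "head H = head G"
    and zero: "\<And>k. k \<in> arcs H \<Longrightarrow> (reduced_incidence G *v u) $ k = 0"
  shows "u = 0"
proof -
  have "potential u (Some k) = potential u None" for k
    by (rule connected_imp_constant_potential[OF H(1)])
      (use zero in \<open>auto simp: H reduced_incidence_mult_vec[OF assms(1)]\<close>)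
  then show ?thesis
    by (simp add: potential_def vec_eq_iff)
qed

section \<open>Continuity of order statistics\<close>

text \<open>
  Order statistics are compared through their thresholds: in a descending list the positions with
  value at least \<open>y\<close> form an initial segment, so counting them decides whether the \<open>r\<close>-th is among
  them.
\<close>

lemma le_nth_largest_iff:
  assumes r: "1 \<le> r" "r \<le> size M"
  shows "y \<le> nth_largest r M \<longleftrightarrow> r \<le> size (filter_mset (\<lambda>v. y \<le> v) M)"
proof -
  define xs where "xs = rev (sorted_list_of_multiset M)"
  have M: "M = mset xs"
    by (simp add: xs_def)
  have len: "length xs = size M"
    by (simp add: M)
  have desc: "xs ! j \<le> xs ! i" if "i \<le> j" "j < length xs" for i j
    using that by (intro sorted_rev_nth_mono) (simp_all add: xs_def)
  define I where "I = {i. i < length xs \<and> y \<le> xs ! i}"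
  have fin: "finite I"
    by (simp add: I_def)
  have "size (filter_mset (\<lambda>v. y \<le> v) M) = card I"
    by (simp add: M I_def flip: mset_filter length_filter_conv_card)
  moreover have "r \<le> card I" if "y \<le> xs ! (r - 1)"
  proof -
    have "{..<r} \<subseteq> I"
    proof
      fix i
      assume "i \<in> {..<r}"
      then have "xs ! (r - 1) \<le> xs ! i" "i < length xs"
        using r len by (simp_all add: desc)
      then show "i \<in> I"
        using that by (simp add: I_def)
    qed
    then show ?thesis
      using card_mono[OF fin, of "{..<r}"] by simp
  qed
  moreover have "card I < r" if "\<not> y \<le> xs ! (r - 1)"
  proof -
    have "I \<subseteq> {..<r - 1}"
    proof
      fix i
      assume i: "i \<in> I"
      then have "\<not> r - 1 \<le> i"
        using desc[of "r - 1" i] that by (auto simp: I_def)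
      then show "i \<in> {..<r - 1}"
        by simp
    qed
    then have "card I \<le> r - 1"
      using card_mono[of "{..<r - 1}" I] by simp
    then show ?thesis
      using r by simp
  qed
  ultimately have "y \<le> xs ! (r - 1) \<longleftrightarrow> r \<le> size (filter_mset (\<lambda>v. y \<le> v) M)"
    by (cases "y \<le> xs ! (r - 1)") (simp_all add: not_le)
  then show ?thesis
    by (simp add: nth_largest_def xs_def)
qed

text \<open>
  At least \<open>r\<close> of the values of \<open>f\<close> reach its \<open>r\<close>-th largest value \<open>y\<close>, and each of these
  indices has a value of \<open>g\<close> that reaches \<open>y - e\<close>.
\<close>

lemma nth_largest_perturb:
  assumes S: "finite S" and r: "1 \<le> r" "r \<le> card S"
    and le: "\<And>s. s \<in> S \<Longrightarrow> f s \<le> g s + e"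
  shows "nth_largest r (image_mset f (mset_set S)) \<le> nth_largest r (image_mset g (mset_set S)) + e"
proof -
  have iff: "y \<le> nth_largest r (image_mset h (mset_set S)) \<longleftrightarrow> r \<le> card {s \<in> S. y \<le> h s}" for y h
    using r by (subst le_nth_largest_iff) (simp_all add: S filter_mset_image_mset)
  define y where "y = nth_largest r (image_mset f (mset_set S))"
  have "r \<le> card {s \<in> S. y \<le> f s}"
    unfolding iff[symmetric] y_def ..
  also have "\<dots> \<le> card {s \<in> S. y - e \<le> g s}"
    using le by (intro card_mono) (force simp: S)+
  finally show ?thesis
    unfolding iff[symmetric] y_def by simp
qed

lemma continuous_on_nth_largest:
  assumes S: "finite S" and r: "1 \<le> r" "r \<le> card S"
    and cont: "\<And>s. s \<in> S \<Longrightarrow> continuous_on X (f s)"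
  shows "continuous_on X (\<lambda>x. nth_largest r (image_mset (\<lambda>s. f s x) (mset_set S)))"
  unfolding continuous_on_def
proof (intro ballI tendstoI)
  fix x and e :: real
  assume x: "x \<in> X" and e: "e > 0"
  have "\<forall>\<^sub>F x' in at x within X. \<forall>s\<in>S. dist (f s x') (f s x) < e / 2"
    using cont x e by (intro eventually_ball_finite S ballI tendstoD) (auto simp: continuous_on_def)
  then show "\<forall>\<^sub>F x' in at x within X. dist (nth_largest r (image_mset (\<lambda>s. f s x') (mset_set S)))
      (nth_largest r (image_mset (\<lambda>s. f s x) (mset_set S))) < e"
  proof eventually_elim
    case (elim x')
    have "f s x' \<le> f s x + e / 2" "f s x \<le> f s x' + e / 2" if "s \<in> S" for s
      using bspec[OF elim that] unfolding dist_real_def by linarith+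
    then show ?case
      using nth_largest_perturb[OF S r, of "\<lambda>s. f s x'" "\<lambda>s. f s x" "e / 2"]
        nth_largest_perturb[OF S r, of "\<lambda>s. f s x" "\<lambda>s. f s x'" "e / 2"] e
      by (auto simp: dist_real_def)
  qed
qed

lemma continuous_on_Max_image:
  fixes f :: "'s \<Rightarrow> 'a::topological_space \<Rightarrow> real"
  assumes "finite S" and "\<And>s. s \<in> S \<Longrightarrow> continuous_on X (f s)"
  shows "continuous_on X (\<lambda>x. Max ((\<lambda>s. f s x) ` S))"
  using assms
proof (induction S rule: finite_induct)
  case (insert s S)
  then show ?case
    by (cases "S = {}") (auto intro!: continuous_on_max)
qed simp

section \<open>The expansion map\<close>

lemma susceptance_eq_diag_of:
  assumes "\<And>j. z j (x $ j) > 0"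
  shows "susceptance z x = diag_of (\<chi> j. 1 / z j (x $ j))"
  unfolding susceptance_def
proof (rule matrix_inv_eqI)
  have "z j (x $ j) \<noteq> 0" for j
    using assms[of j] by simp
  then show "diag_of (\<chi> j. z j (x $ j)) ** diag_of (\<chi> j. 1 / z j (x $ j)) = mat 1"
    by (simp add: diag_of_def matrix_matrix_mult_def mat_def vec_eq_iff if_distrib[of "\<lambda>a. a * _"] cong: if_cong)
qed

context
  fixes G :: "('n::finite option, 'b::finite) pre_digraph"
    and z :: "'b \<Rightarrow> real \<Rightarrow> real" and xbar :: "real^'b"
  assumes net: "network G"
    and z_cont: "\<And>j. continuous_on {0..xbar $ j} (z j)"
    and z_pos: "\<And>j s. s \<in> {0..xbar $ j} \<Longrightarrow> z j s > 0"
begin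

lemma susceptance_on_box:
  assumes "x \<in> {0..xbar}"
  shows "susceptance z x = diag_of (\<chi> j. 1 / z j (x $ j))" "(\<chi> j. 1 / z j (x $ j)) $ k > 0"
  using assms z_pos by (auto intro!: susceptance_eq_diag_of simp: less_eq_vec_def)

lemma continuous_on_susceptance: "continuous_on {0..xbar} (susceptance z)"
proof -
  have "continuous_on {0..xbar} (\<lambda>x. z j (x $ j))" for j
    by (rule continuous_on_compose2[OF z_cont[of j]]) (auto intro!: continuous_intros simp: less_eq_vec_def)
  moreover have "z j (x $ j) \<noteq> 0" if "x \<in> {0..xbar}" for j x
    using z_pos[of "x $ j" j] that by (force simp: less_eq_vec_def)
  ultimately have "continuous_on {0..xbar} (\<lambda>x. if i = j then (\<chi> k. 1 / z k (x $ k)) $ i else 0)" for i j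
    by (cases "i = j") (auto intro!: continuous_intros)
  then have "continuous_on {0..xbar} (\<lambda>x. diag_of (\<chi> j. 1 / z j (x $ j)))"
    unfolding diag_of_def by (intro continuous_on_vec_lambda)
  then show ?thesis
    by (rule continuous_on_eq) (simp add: susceptance_on_box)
qed

lemma continuous_on_ptdf: "continuous_on {0..xbar} (ptdf G z)"
  unfolding ptdf_def Let_def
proof (intro continuous_on_matrix_mult continuous_on_matrix_inv continuous_on_susceptance continuous_on_const)
  fix x
  assume "x \<in> {0..xbar}"
  moreover have "u = 0" if "reduced_incidence G *v u = 0" for u
    using net that by (intro connected_subnetwork_potential_eq_0[of G G]) (auto simp: network_def)
  ultimately show "invertible (transpose (reduced_incidence G) ** susceptance z x ** reduced_incidence G)"
    by (simp only: susceptance_on_box weighted_gram_invertible)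
qed

lemma lodf_denominator_neq_0:
  assumes "x \<in> {0..xbar}" and j: "j \<in> non_bridges G"
  shows "1 - (ptdf G z x ** transpose (reduced_incidence G)) $ j $ j \<noteq> 0"
proof -
  have "u = 0" if "\<And>k. k \<noteq> j \<Longrightarrow> (reduced_incidence G *v u) $ k = 0" for u
    using net j that
    by (intro connected_subnetwork_potential_eq_0[of G "pre_digraph.del_arc G j"])
      (auto simp: network_def non_bridges_def pre_digraph.del_arc_simps)
  then show ?thesis
    using weighted_gram_projection_diag_neq_1[where A = "reduced_incidence G" and j = j,
        OF susceptance_on_box(2)[OF assms(1)]]
    by (auto simp: ptdf_def Let_def susceptance_on_box(1)[OF assms(1)])
qed

lemma continuous_on_base_flow: "continuous_on {0..xbar} (\<lambda>x. base_flow G z p x \<omega> t i)"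
  unfolding base_flow_def by (intro continuous_intros continuous_on_ptdf)

lemma continuous_on_contingency_flow:
  assumes "j \<in> non_bridges G"
  shows "continuous_on {0..xbar} (\<lambda>x. contingency_flow G z p x \<omega> t i j)"
  unfolding contingency_flow_def lodf_def Let_def
  using lodf_denominator_neq_0[OF _ assms]
  by (auto intro!: continuous_intros continuous_on_base_flow continuous_on_matrix_mult continuous_on_ptdf)

lemma continuous_on_capacity_lb:
  assumes "finite \<Omega>"
  shows "continuous_on {0..xbar} (\<lambda>x. capacity_lb G z w \<Omega> T p x i)"
proof -
  have "{base_violation G z w p x \<omega> t i | \<omega> t. \<omega> \<in> \<Omega> \<and> t \<in> {1..T}}
      = (\<lambda>(\<omega>, t). base_violation G z w p x \<omega> t i) ` (\<Omega> \<times> {1..T})" for x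
    by (auto simp: image_iff) blast+
  moreover have "continuous_on {0..xbar}
      (\<lambda>x. Max ((\<lambda>s. case s of (\<omega>, t) \<Rightarrow> base_violation G z w p x \<omega> t i) ` (\<Omega> \<times> {1..T})))"
    using assms unfolding base_violation_def
    by (intro continuous_on_Max_image) (auto intro!: continuous_intros continuous_on_max continuous_on_base_flow)
  ultimately show ?thesis
    by (simp only: capacity_lb_def)
qed

lemma continuous_on_optimal_upgrade:
  assumes "finite \<Omega>" and "1 \<le> upgrade_rank \<eta> c cvio i"
    and "upgrade_rank \<eta> c cvio i \<le> card (\<Omega> \<times> {1..T} \<times> (non_bridges G - {i}))"
  shows "continuous_on {0..xbar} (\<lambda>x. optimal_upgrade G z w \<eta> c cvio \<Omega> T p x i)"
  unfolding optimal_upgrade_def violation_array_def contingency_violation_def divide_inverse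
  using assms
  by (intro continuous_on_nth_largest)
    (auto intro!: continuous_intros continuous_on_max continuous_on_contingency_flow)

end

theorem proposition4:
  fixes G :: "('n::finite option, 'b::finite) pre_digraph"
    and z :: "'b \<Rightarrow> real \<Rightarrow> real"
    and w xbar c xstar :: "real^'b"
    and \<eta> cvio :: real
    and \<Omega> :: "'w set"
    and T :: nat
    and p :: "'w \<Rightarrow> nat \<Rightarrow> real^('n option)"
  assumes "network G"
    and "\<And>j. w $ j \<ge> 0"
    and "\<And>j. xbar $ j \<ge> 0"
    and "\<And>j. continuous_on {0..xbar $ j} (z j)"
    and "\<And>j s. s \<in> {0..xbar $ j} \<Longrightarrow> z j s > 0"
    and "finite \<Omega>"
    and "\<And>i. c $ i > 0"
    and "cvio > 0"
    and "\<eta> \<ge> 1"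
    and "xstar \<in> {0..xbar}"
    and "\<And>i. upgrade_rank \<eta> c cvio i \<le> card (\<Omega> \<times> {1..T} \<times> (non_bridges G - {i}))"
  shows "\<exists>x\<in>{0..xbar}. x = expansion_map G z w xbar \<eta> c cvio \<Omega> T p xstar x"
proof -
  \<comment> \<open>Positive unit costs make every rank at least \<open>1\<close>, so each rank selects a genuine entry of its array.\<close>
  have rank: "1 \<le> upgrade_rank \<eta> c cvio i" for i
  proof -
    have "0 < c $ i / (\<eta> * cvio)"
      using assms(7)[of i] assms(8,9) by simp
    then have "0 < \<lceil>c $ i / (\<eta> * cvio)\<rceil>"
      by (simp only: zero_less_ceiling)
    then have "0 < upgrade_rank \<eta> c cvio i"
      by (simp only: upgrade_rank_def zero_less_nat_eq)
    then show ?thesis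
      by simp
  qed
  let ?E = "expansion_map G z w xbar \<eta> c cvio \<Omega> T p xstar"
  have E_eq: "?E = (\<lambda>x. \<chi> i. min (max (xstar $ i) (max (capacity_lb G z w \<Omega> T p x i)
      (optimal_upgrade G z w \<eta> c cvio \<Omega> T p x i))) (xbar $ i))"
    by (simp add: expansion_map_def fun_eq_iff)
  have "continuous_on {0..xbar} ?E"
    unfolding E_eq
    by (intro continuous_intros continuous_on_min continuous_on_max
        continuous_on_capacity_lb[OF assms(1,4,5,6)]
        continuous_on_optimal_upgrade[OF assms(1,4,5,6) rank assms(11)])
  moreover have "?E \<in> {0..xbar} \<rightarrow> {0..xbar}"
    using assms(3,10) by (auto simp: E_eq less_eq_vec_def le_max_iff_disj)
  moreover have "compact {0..xbar}" "convex {0..xbar}"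
    by (simp_all add: interval_cbox)
  moreover have "{0..xbar} \<noteq> {}"
    using assms(10) by auto
  ultimately show ?thesis
    by (metis brouwer)
qed

end
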